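(* For all $\delta,\delta'\in\{\mathbf{CInd},\mathbf{T}\}$ and $\mathcal{C}\in\{\mathcal{R},\mathcal{P}\}$ we have $[\tau(\delta')\mathcal{C}\mathbf{Txt}\mathbf{It}\delta\mathbf{Ex}_C]_{\mathbf{REC}} \subseteq [\tau(\delta')\mathcal{C}\mathbf{Txt}\mathbf{Sd}\delta\mathbf{Ex}_C]_{\mathbf{REC}}$.
   Context: Fix an acceptable numbering $(\varphi_e)_{e\in\mathbb{N}}$ of all partial computable functions. A number $e$ is a $C$-index if $\varphi_e$ is total with values in $\{0,1\}$; then $C_e=\{x:\varphi_e(x)=1\}$. $\mathbf{REC}$ is the collection of recursive subsets of $\mathbb{N}$; $\mathcal{P}$ and $\mathcal{R}$ are the partial computable and total computable functions. Fix a pause symbol $\#$. A text is a total function $T:\mathbb{N}\to\mathbb{N}\cup\{\#\}$, $\mathrm{content}(T)=\mathrm{range}(T)\setminus\{\#\}$, $T$ is a text for $L$ if $\mathrm{content}(T)=L$, $T[n]=(T(0),\dots,T(n-1))$, and content of finite sequences is defined likewise. A learner is some $h\in\mathcal{P}$ (finite sequences/sets coded as numbers). Hypothesis sequences: set-driven $\mathbf{Sd}(h,T)(i)=h(\mathrm{content}(T[i]))$; iterative $\mathbf{It}(h,T)(0)=h(\varepsilon)$ ($\varepsilon$ the empty sequence) and $\mathbf{It}(h,T)(i)=h(\mathbf{It}(h,T)(i-1),T(i-1))$ for $i>0$. Restrictions on a hypothesis sequence $p$ and text $T$: $\mathbf{Ex}_C$: there is $n_0$ with $p(n)=p(n_0)$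 for all $n\ge n_0$ and $p(n_0)$ a $C$-index with $C_{p(n_0)}=\mathrm{content}(T)$; $\mathbf{CInd}$: for all $i$, $p(i)$ is a $C$-index; $\mathbf{T}$: always true. Juxtaposition of restrictions means conjunction. For $\mathcal{C}\in\{\mathcal{P},\mathcal{R}\}$, a learner $h\in\mathcal{C}$ $\tau(\alpha)\mathcal{C}\mathbf{Txt}\beta\delta$-learns $L$ iff $\alpha(\beta(h,T),T)$ holds for every text $T$ whatsoever and $\delta(\beta(h,T),T)$ holds for every text $T$ for $L$. $[\tau(\alpha)\mathcal{C}\mathbf{Txt}\beta\delta]_{\mathbf{REC}}$ is the set of all classes $\mathcal{L}\subseteq\mathbf{REC}$ for which some $h\in\mathcal{C}$ learns every $L\in\mathcal{L}$ in this sense. *)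

theory Defs
  imports "HOL-Library.Nat_Bijection"
begin

text \<open>An n-ary partial function is a map on argument
  lists, of which only the values on lists of length n are relevant.\<close>

inductive partial_recursive :: "nat \<Rightarrow> (nat list \<Rightarrow> nat option) \<Rightarrow> bool" where
  zero: "partial_recursive n (\<lambda>xs. Some 0)"
| succ: "partial_recursive 1 (\<lambda>xs. Some (Suc (hd xs)))"
| proj: "i < n \<Longrightarrow> partial_recursive n (\<lambda>xs. Some (xs ! i))"
| comp: "partial_recursive m f \<Longrightarrow> length gs = m \<Longrightarrow> \<forall>g\<in>set gs. partial_recursive n g \<Longrightarrow>
    partial_recursive n (\<lambda>xs. Option.bind (those (map (\<lambda>g. g xs) gs)) f)"
| prim_rec: "partial_recursive n f \<Longrightarrow> partial_recursive (Suc (Suc n)) g \<Longrightarrow>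
    partial_recursive (Suc n)
      (\<lambda>xs. rec_nat (f (tl xs)) (\<lambda>k r. Option.bind r (\<lambda>v. g (k # v # tl xs))) (hd xs))"
| minimization: "partial_recursive (Suc n) f \<Longrightarrow>
    partial_recursive n
      (\<lambda>xs. if \<exists>k. f (k # xs) = Some 0 \<and> (\<forall>j<k. f (j # xs) \<noteq> None)
            then Some (LEAST k. f (k # xs) = Some 0) else None)"

definition partial_computable :: "(nat \<Rightarrow> nat option) set" where
  "partial_computable = {f. \<exists>F. partial_recursive 1 F \<and> (\<forall>x. f x = F [x])}"

definition total_computable :: "(nat \<Rightarrow> nat option) set" where
  "total_computable = {f \<in> partial_computable. \<forall>x. f x \<noteq> None}"

definition partial_computable2 :: "(nat \<Rightarrow> nat \<Rightarrow> nat option) set" where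
  "partial_computable2 = {f. \<exists>F. partial_recursive 2 F \<and> (\<forall>x y. f x y = F [x, y])}"

text \<open>Acceptability in the sense of Rogers: the numbering is effective, and every effective
  numbering can be translated into it computably. That it enumerates exactly the
  partial computable functions follows (lemma \<open>range_acceptable_numbering\<close>).\<close>

definition acceptable_numbering :: "(nat \<Rightarrow> nat \<Rightarrow> nat option) \<Rightarrow> bool" where
  "acceptable_numbering \<phi> \<longleftrightarrow>
     \<phi> \<in> partial_computable2 \<and>
     (\<forall>\<psi>\<in>partial_computable2. \<exists>t. (\<lambda>e. Some (t e)) \<in> total_computable \<and> (\<forall>e. \<phi> (t e) = \<psi> e))"

lemma partial_recursive_const: "partial_recursive n (\<lambda>xs. Some c)"
proof (induction c)
  case 0
  show ?case by (rule zero)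
next
  case (Suc c)
  from comp[OF succ, of "[\<lambda>xs. Some c]" n] Suc show ?case by simp
qed

lemma range_acceptable_numbering:
  assumes "acceptable_numbering \<phi>"
  shows "range \<phi> = partial_computable"
proof
  show "range \<phi> \<subseteq> partial_computable"
  proof
    fix f assume "f \<in> range \<phi>"
    then obtain e where f: "f = \<phi> e" by blast
    from assms obtain F where F: "partial_recursive 2 F" "\<forall>x y. \<phi> x y = F [x, y]"
      by (auto simp: acceptable_numbering_def partial_computable2_def)
    have "partial_recursive 1
        (\<lambda>xs. Option.bind (those (map (\<lambda>g. g xs) [\<lambda>xs. Some e, \<lambda>xs. Some (xs ! 0)])) F)"
      by (rule comp[OF F(1)]) (auto intro: partial_recursive_const proj)
    with F(2) show "f \<in> partial_computable"
      unfolding partial_computable_def f by (auto intro!: exI)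
  qed
next
  show "partial_computable \<subseteq> range \<phi>"
  proof
    fix f assume "f \<in> partial_computable"
    then obtain F where F: "partial_recursive 1 F" "\<forall>x. f x = F [x]"
      by (auto simp: partial_computable_def)
    have "partial_recursive 2
        (\<lambda>xs. Option.bind (those (map (\<lambda>g. g xs) [\<lambda>xs. Some (xs ! 1)])) F)"
      by (rule comp[OF F(1)]) (auto intro: proj)
    with F(2) have "(\<lambda>e. f) \<in> partial_computable2"
      unfolding partial_computable2_def by (auto intro!: exI)
    with assms obtain t where "\<forall>e. \<phi> (t e) = f"
      unfolding acceptable_numbering_def by fastforce
    then show "f \<in> range \<phi>" by (metis rangeI)
  qed
qed

definition REC :: "nat set set" where
  "REC = {L. (\<lambda>x. Some (if x \<in> L then 1 else 0)) \<in> total_computable}"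

definition is_C_index :: "(nat \<Rightarrow> nat \<Rightarrow> nat option) \<Rightarrow> nat \<Rightarrow> bool" where
  "is_C_index \<phi> e \<longleftrightarrow> (\<forall>x. \<phi> e x \<in> {Some 0, Some 1})"

definition C_set :: "(nat \<Rightarrow> nat \<Rightarrow> nat option) \<Rightarrow> nat \<Rightarrow> nat set" where
  "C_set \<phi> e = {x. \<phi> e x = Some 1}"

text \<open>\<open>None\<close> is the pause symbol.\<close>

type_synonym datum = "nat option"
type_synonym nat_text = "nat \<Rightarrow> datum"

definition content :: "nat_text \<Rightarrow> nat set" where
  "content T = Option.these (range T)"

definition content_seq :: "datum list \<Rightarrow> nat set" where
  "content_seq \<sigma> = Option.these (set \<sigma>)"

definition is_text_for :: "nat_text \<Rightarrow> nat set \<Rightarrow> bool" where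
  "is_text_for T L \<longleftrightarrow> content T = L"

definition text_prefix :: "nat_text \<Rightarrow> nat \<Rightarrow> datum list" where
  "text_prefix T n = map T [0..<n]"

text \<open>Learners are partial, so a hypothesis sequence may be undefined (\<open>None\<close>) at some
  positions.\<close>

type_synonym learner = "nat \<Rightarrow> nat option"
type_synonym hyp_seq = "nat \<Rightarrow> nat option"

definition datum_encode :: "datum \<Rightarrow> nat" where
  "datum_encode d = (case d of None \<Rightarrow> 0 | Some x \<Rightarrow> Suc x)"

definition Sd :: "learner \<Rightarrow> nat_text \<Rightarrow> hyp_seq" where
  "Sd h T i = h (set_encode (content_seq (text_prefix T i)))"

text \<open>The two kinds of input of an iterative learner, the empty sequence and a pair of hypothesis
  and datum, are coded as lists, so that their codes are disjoint.\<close>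

fun It :: "learner \<Rightarrow> nat_text \<Rightarrow> hyp_seq" where
  "It h T 0 = h (list_encode [])"
| "It h T (Suc i) = Option.bind (It h T i) (\<lambda>e. h (list_encode [e, datum_encode (T i)]))"

type_synonym restriction = "hyp_seq \<Rightarrow> nat_text \<Rightarrow> bool"

definition Ex_C :: "(nat \<Rightarrow> nat \<Rightarrow> nat option) \<Rightarrow> restriction" where
  "Ex_C \<phi> p T \<longleftrightarrow> (\<exists>n\<^sub>0 e. p n\<^sub>0 = Some e \<and> (\<forall>n\<ge>n\<^sub>0. p n = p n\<^sub>0) \<and>
     is_C_index \<phi> e \<and> C_set \<phi> e = content T)"

definition CInd :: "(nat \<Rightarrow> nat \<Rightarrow> nat option) \<Rightarrow> restriction" where
  "CInd \<phi> p T \<longleftrightarrow> (\<forall>i. \<exists>e. p i = Some e \<and> is_C_index \<phi> e)"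

definition no_restriction :: restriction where
  "no_restriction p T \<longleftrightarrow> True"

definition restriction_conj :: "restriction \<Rightarrow> restriction \<Rightarrow> restriction" where
  "restriction_conj \<delta> \<epsilon> p T \<longleftrightarrow> \<delta> p T \<and> \<epsilon> p T"

definition learns ::
  "restriction \<Rightarrow> (learner \<Rightarrow> nat_text \<Rightarrow> hyp_seq) \<Rightarrow> restriction \<Rightarrow> learner \<Rightarrow> nat set \<Rightarrow> bool" where
  "learns \<alpha> \<beta> \<delta> h L \<longleftrightarrow>
     (\<forall>T. \<alpha> (\<beta> h T) T) \<and> (\<forall>T. is_text_for T L \<longrightarrow> \<delta> (\<beta> h T) T)"

text \<open>\<open>learnable_REC \<alpha> \<C> \<beta> \<delta>\<close> is \<open>[\<tau>(\<alpha>)\<C>Txt\<beta>\<delta>]\<^bsub>REC\<^esub>\<close>.\<close>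

definition learnable_REC ::
  "restriction \<Rightarrow> learner set \<Rightarrow> (learner \<Rightarrow> nat_text \<Rightarrow> hyp_seq) \<Rightarrow> restriction \<Rightarrow> nat set set set" where
  "learnable_REC \<alpha> \<C> \<beta> \<delta> = {\<L>. \<L> \<subseteq> REC \<and> (\<exists>h\<in>\<C>. \<forall>L\<in>\<L>. learns \<alpha> \<beta> \<delta> h L)}"

end

theory Submission
  imports Defs "HOL-Library.Infinite_Set"
begin

text \<open>Given an iterative learner, feed it, for a finite set \<open>D\<close> with code \<open>c\<close>, the
  sequence whose entries at \<open>2y\<close> are \<open>y\<close> if \<open>y \<in> D\<close> and a pause otherwise,
  with a pause at every odd position, up to position \<open>2c\<close>, beyond which there are only pauses.
  If one more pause leaves the resulting hypothesis unchanged, output it, and otherwise output a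
  \<open>C\<close>-index of \<open>D\<close> itself. On an infinite target \<open>L\<close> the iterative learner converges on
  the sequence built from \<open>L\<close>; past the point of convergence neither pauses nor elements of
  \<open>L\<close> change its hypothesis, so omitting some of these elements is harmless. On a finite
  target the input eventually is \<open>L\<close>, and a hypothesis stable under pauses is the limit on a
  text for \<open>L\<close>.\<close>

section \<open>Closure properties of partial recursive functions\<close>

text \<open>In contrast to \<^const>\<open>partial_recursive\<close>, this does not constrain the values on lists of
  the wrong length.\<close>

definition partial_rec :: "nat \<Rightarrow> (nat list \<Rightarrow> nat option) \<Rightarrow> bool" where
  "partial_rec n f \<longleftrightarrow> (\<exists>F. partial_recursive n F \<and> (\<forall>xs. length xs = n \<longrightarrow> F xs = f xs))"

abbreviation total_rec :: "nat \<Rightarrow> (nat list \<Rightarrow> nat) \<Rightarrow> bool" where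
  "total_rec n f \<equiv> partial_rec n (\<lambda>xs. Some (f xs))"

section \<open>Composition, binding and recursion\<close>

lemma partial_rec_cong: "partial_rec n f \<Longrightarrow> (\<And>xs. length xs = n \<Longrightarrow> f xs = g xs) \<Longrightarrow> partial_rec n g"
  unfolding partial_rec_def by force

lemma total_rec_const: "total_rec n (\<lambda>xs. c)"
  unfolding partial_rec_def using partial_recursive_const by blast

lemma total_rec_nth: "i < n \<Longrightarrow> total_rec n (\<lambda>xs. xs ! i)"
  unfolding partial_rec_def using proj by blast

text \<open>In \<open>partial_rec_bind\<close> and \<open>partial_rec_rec_nat\<close> the bound
  values go in front of the argument list, so an outer argument reappears behind one or two
  \<open>tl\<close>.\<close>

lemma total_rec_nth_tl: "Suc i < n \<Longrightarrow> total_rec n (\<lambda>xs. tl xs ! i)"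
  by (rule partial_rec_cong[OF total_rec_nth[of "Suc i"]]) (auto simp: nth_tl)

lemma total_rec_nth_tl_tl: "Suc (Suc i) < n \<Longrightarrow> total_rec n (\<lambda>xs. tl (tl xs) ! i)"
  by (rule partial_rec_cong[OF total_rec_nth[of "Suc (Suc i)"]]) (auto simp: nth_tl)

lemma length_those: "those ys = Some zs \<Longrightarrow> length zs = length ys"
  by (induction ys arbitrary: zs) (auto split: option.splits)

lemma partial_rec_comp:
  assumes f: "partial_rec (length gs) f" and gs: "\<forall>g\<in>set gs. partial_rec n g"
  shows "partial_rec n (\<lambda>xs. Option.bind (those (map (\<lambda>g. g xs) gs)) f)"
proof -
  obtain F where F: "partial_recursive (length gs) F"
      "\<And>xs. length xs = length gs \<Longrightarrow> F xs = f xs"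
    using f unfolding partial_rec_def by blast
  have "\<forall>g\<in>set gs. \<exists>G. partial_recursive n G \<and> (\<forall>xs. length xs = n \<longrightarrow> G xs = g xs)"
    using gs unfolding partial_rec_def by blast
  then obtain G where G: "\<forall>g\<in>set gs. partial_recursive n (G g) \<and>
      (\<forall>xs. length xs = n \<longrightarrow> G g xs = g xs)"
    by metis
  have "partial_recursive n (\<lambda>xs. Option.bind (those (map (\<lambda>g. g xs) (map G gs))) F)"
    using F(1) G by (intro comp) auto
  moreover have "Option.bind (those (map (\<lambda>g. g xs) (map G gs))) F =
      Option.bind (those (map (\<lambda>g. g xs) gs)) f" if "length xs = n" for xs
  proof -
    have "map (\<lambda>g. g xs) (map G gs) = map (\<lambda>g. g xs) gs"
      using G that by auto
    moreover have "F zs = f zs" if "those (map (\<lambda>g. g xs) gs) = Some zs" for zs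
      using length_those[OF that] F(2) by simp
    ultimately show ?thesis
      by (intro Option.bind_cong) (simp_all only:)
  qed
  ultimately show ?thesis
    unfolding partial_rec_def by blast
qed

lemma those_map_nth:
  fixes xs :: "nat list"
  shows "those (map (\<lambda>g. g xs) (map (\<lambda>i xs. Some (xs ! i)) [0..<length xs])) = Some xs"
proof -
  have "those (map Some ys) = Some ys" for ys :: "nat list"
    by (induction ys) auto
  moreover have "map (\<lambda>g. g xs) (map (\<lambda>i xs. Some (xs ! i)) [0..<length xs]) = map Some xs"
    by (rule nth_equalityI) auto
  ultimately show ?thesis by (simp only:)
qed

text \<open>Composing with \<open>f\<close> followed by all projections makes the bound value
  argument 0 and shifts the others by one.\<close>

lemma partial_rec_bind:
  assumes f: "partial_rec n f" and g: "partial_rec (Suc n) (\<lambda>zs. g (zs ! 0) (tl zs))"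
  shows "partial_rec n (\<lambda>xs. Option.bind (f xs) (\<lambda>v. g v xs))"
proof -
  let ?ps = "map (\<lambda>i xs. Some (xs ! i)) [0..<n]"
  have "partial_rec n (\<lambda>xs. Option.bind (those (map (\<lambda>g. g xs) (f # ?ps))) (\<lambda>zs. g (zs ! 0) (tl zs)))"
    by (rule partial_rec_comp) (use assms in \<open>auto intro: total_rec_nth\<close>)
  then show ?thesis
  proof (rule partial_rec_cong)
    fix xs :: "nat list" assume "length xs = n"
    then show "Option.bind (those (map (\<lambda>g. g xs) (f # ?ps))) (\<lambda>zs. g (zs ! 0) (tl zs)) =
        Option.bind (f xs) (\<lambda>v. g v xs)"
      using those_map_nth[of xs] by (cases "f xs") (simp_all del: map_map)
  qed
qed

lemma partial_rec_rec_nat: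
  assumes a: "partial_rec n a" and b: "total_rec n b"
    and s: "partial_rec (Suc (Suc n)) (\<lambda>zs. s (zs ! 0) (zs ! 1) (tl (tl zs)))"
  shows "partial_rec n (\<lambda>xs. rec_nat (a xs) (\<lambda>k r. Option.bind r (\<lambda>v. s k v xs)) (b xs))"
proof -
  obtain A where A: "partial_recursive n A" "\<And>xs. length xs = n \<Longrightarrow> A xs = a xs"
    using a unfolding partial_rec_def by blast
  obtain S where S: "partial_recursive (Suc (Suc n)) S"
      "\<And>zs. length zs = Suc (Suc n) \<Longrightarrow> S zs = s (zs ! 0) (zs ! 1) (tl (tl zs))"
    using s unfolding partial_rec_def by blast
  let ?R = "\<lambda>zs. rec_nat (A (tl zs)) (\<lambda>k r. Option.bind r (\<lambda>v. S (k # v # tl zs))) (hd zs)"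
  have "partial_rec (Suc n) (\<lambda>zs. rec_nat (a (tl zs))
      (\<lambda>k r. Option.bind r (\<lambda>v. s k v (tl zs))) (zs ! 0))"
  proof (rule partial_rec_cong)
    show "partial_rec (Suc n) ?R"
      unfolding partial_rec_def using prim_rec[OF A(1) S(1)] by blast
  next
    fix zs :: "nat list" assume "length zs = Suc n"
    then obtain k xs where zs: "zs = k # xs" "length xs = n"
      by (cases zs) auto
    show "?R zs = rec_nat (a (tl zs)) (\<lambda>k r. Option.bind r (\<lambda>v. s k v (tl zs))) (zs ! 0)"
      using zs A(2) S(2) by simp
  qed
  \<comment> \<open>The recursion scheme recurses on the first argument; binding \<open>b\<close>
    there allows any computed number of steps.\<close>
  from partial_rec_bind[OF b this] show ?thesis by simp
qed

lemma total_rec_rec_nat: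
  assumes "total_rec n a" "total_rec n b"
    and "total_rec (Suc (Suc n)) (\<lambda>zs. s (zs ! 0) (zs ! 1) (tl (tl zs)))"
  shows "total_rec n (\<lambda>xs. rec_nat (a xs) (\<lambda>k v. s k v xs) (b xs))"
proof -
  have "rec_nat (Some (a xs)) (\<lambda>k r. Option.bind r (\<lambda>v. Some (s k v xs))) m =
      Some (rec_nat (a xs) (\<lambda>k v. s k v xs) m)" for xs m
    by (induction m) auto
  with partial_rec_rec_nat[OF assms] show ?thesis by simp
qed

lemma partial_rec_comp1:
  assumes "partial_rec 1 (\<lambda>xs. f (xs ! 0))" "total_rec n g"
  shows "partial_rec n (\<lambda>xs. f (g xs))"
  using partial_rec_comp[of "[\<lambda>xs. Some (g xs)]" "\<lambda>xs. f (xs ! 0)" n] assms by simp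

lemma partial_rec_comp2:
  assumes "partial_rec 2 (\<lambda>xs. f (xs ! 0) (xs ! 1))" "total_rec n g" "total_rec n h"
  shows "partial_rec n (\<lambda>xs. f (g xs) (h xs))"
  using partial_rec_comp[of "[\<lambda>xs. Some (g xs), \<lambda>xs. Some (h xs)]" "\<lambda>xs. f (xs ! 0) (xs ! 1)" n] assms
  by (simp add: numeral_2_eq_2)

section \<open>Arithmetic, case distinctions and codes\<close>

lemma total_rec_Suc:
  assumes "total_rec n g"
  shows "total_rec n (\<lambda>xs. Suc (g xs))"
proof -
  have "partial_rec 1 (\<lambda>xs. Some (Suc (xs ! 0)))"
  proof (rule partial_rec_cong)
    show "partial_rec 1 (\<lambda>xs. Some (Suc (hd xs)))"
      unfolding partial_rec_def using succ by blast
  qed (auto simp: length_Suc_conv)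
  from partial_rec_comp1[OF this assms] show ?thesis .
qed

lemmas total_rec_intros = total_rec_const total_rec_nth total_rec_nth_tl total_rec_nth_tl_tl total_rec_Suc

text \<open>A case distinction is a recursion on \<open>b\<close> whose step ignores the previous
  value: no step leaves \<open>x\<close>, any positive number of steps gives
  \<open>y\<close>.\<close>

lemma total_rec_if_zero:
  assumes "total_rec n b" "total_rec n x" "total_rec n y"
  shows "total_rec n (\<lambda>xs. if b xs = 0 then x xs else y xs)"
proof -
  have "total_rec (Suc (Suc n)) (\<lambda>zs. y (tl (tl zs)))"
  proof -
    \<comment> \<open>Counter and previous value come first in a recursion step, so \<open>y\<close>
      is composed with the projections from position 2 on.\<close>
    let ?ps = "map (\<lambda>i xs. Some (xs ! Suc (Suc i))) [0..<n]"
    have "partial_rec (Suc (Suc n)) (\<lambda>zs. Option.bind (those (map (\<lambda>g. g zs) ?ps)) (\<lambda>xs. Some (y xs)))"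
      by (rule partial_rec_comp) (use assms in \<open>auto intro: total_rec_nth\<close>)
    then show ?thesis
    proof (rule partial_rec_cong)
      fix zs :: "nat list" assume "length zs = Suc (Suc n)"
      then obtain u v xs where zs: "zs = u # v # xs" "length xs = n"
        by (auto simp: length_Suc_conv)
      show "Option.bind (those (map (\<lambda>g. g zs) ?ps)) (\<lambda>xs. Some (y xs)) = Some (y (tl (tl zs)))"
        using those_map_nth[of xs] zs by (simp add: comp_def)
    qed
  qed
  from total_rec_rec_nat[OF assms(2,1) this]
  have "total_rec n (\<lambda>xs. rec_nat (x xs) (\<lambda>k v. y xs) (b xs))" .
  moreover have "rec_nat p (\<lambda>k v. q) m = (if m = 0 then p else q)" for p q :: nat and m
    by (cases m) auto
  ultimately show ?thesis by simp
qed

lemma total_rec_add: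
  assumes "total_rec n g" "total_rec n h"
  shows "total_rec n (\<lambda>xs. g xs + h xs)"
proof -
  have "total_rec 2 (\<lambda>xs. rec_nat (xs ! 0) (\<lambda>k v. Suc v) (xs ! 1))"
    by (intro total_rec_rec_nat total_rec_intros) auto
  moreover have "rec_nat a (\<lambda>k v. Suc v) b = a + b" for a b
    by (induction b) auto
  ultimately have "total_rec 2 (\<lambda>xs. xs ! 0 + xs ! 1)" by simp
  from partial_rec_comp2[OF this assms] show ?thesis .
qed

lemma total_rec_diff:
  assumes "total_rec n g" "total_rec n h"
  shows "total_rec n (\<lambda>xs. g xs - h xs)"
proof -
  have "total_rec 1 (\<lambda>xs. rec_nat 0 (\<lambda>k v. k) (xs ! 0))"
    by (intro total_rec_rec_nat total_rec_intros) auto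
  moreover have "rec_nat 0 (\<lambda>k v. k) a = a - 1" for a
    by (induction a) auto
  ultimately have pred: "total_rec 1 (\<lambda>xs. xs ! 0 - 1)" by simp
  have "total_rec 2 (\<lambda>xs. rec_nat (xs ! 0) (\<lambda>k v. v - 1) (xs ! 1))"
    by (intro total_rec_rec_nat total_rec_intros partial_rec_comp1[OF pred]) auto
  moreover have "rec_nat a (\<lambda>k v. v - 1) b = a - b" for a b
    by (induction b) auto
  ultimately have "total_rec 2 (\<lambda>xs. xs ! 0 - xs ! 1)" by simp
  from partial_rec_comp2[OF this assms] show ?thesis .
qed

lemma total_rec_if_eq:
  assumes "total_rec n a" "total_rec n b" "total_rec n x" "total_rec n y"
  shows "total_rec n (\<lambda>xs. if a xs = b xs then x xs else y xs)"
proof -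
  have "total_rec n (\<lambda>xs. if (a xs - b xs) + (b xs - a xs) = 0 then x xs else y xs)"
    using assms by (intro total_rec_if_zero total_rec_add total_rec_diff)
  moreover have "(a - b) + (b - a) = 0 \<longleftrightarrow> a = b" for a b :: nat
    by auto
  ultimately show ?thesis by (simp only:)
qed

text \<open>\<open>triangle\<close> is the quadratic part of \<open>prod_encode\<close>, from which
  the codes of the iterative learner's inputs are built.\<close>

lemma total_rec_triangle:
  assumes "total_rec n g"
  shows "total_rec n (\<lambda>xs. triangle (g xs))"
proof -
  have "total_rec 1 (\<lambda>xs. rec_nat 0 (\<lambda>k v. v + Suc k) (xs ! 0))"
    by (intro total_rec_rec_nat total_rec_add total_rec_intros) auto
  moreover have "rec_nat 0 (\<lambda>k v. v + Suc k) a = triangle a" for a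
    by (induction a) auto
  ultimately have "total_rec 1 (\<lambda>xs. triangle (xs ! 0))" by simp
  from partial_rec_comp1[OF this assms] show ?thesis .
qed

lemma total_rec_list_encode_pair:
  assumes "total_rec n g" "total_rec n h"
  shows "total_rec n (\<lambda>xs. list_encode [g xs, h xs])"
  using assms by (simp add: prod_encode_def) (intro total_rec_intros total_rec_add total_rec_triangle)

text \<open>Membership means that bit \<open>a\<close> of \<open>c\<close> is 1, that is,
  \<open>c div 2 ^ a\<close> is odd. Parity, halving and shifting are each obtained by
  iteration.\<close>

lemma total_rec_if_mem_set_decode:
  assumes "total_rec n a" "total_rec n c" "total_rec n x" "total_rec n y"
  shows "total_rec n (\<lambda>xs. if a xs \<in> set_decode (c xs) then x xs else y xs)"
proof -
  have "total_rec 1 (\<lambda>xs. rec_nat 0 (\<lambda>k v. 1 - v) (xs ! 0))"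
    by (intro total_rec_rec_nat total_rec_diff total_rec_intros) auto
  moreover have "rec_nat 0 (\<lambda>k v. 1 - v) m = m mod 2" for m :: nat
    by (induction m) (simp, simp add: mod_Suc)
  ultimately have mod2: "total_rec 1 (\<lambda>xs. xs ! 0 mod 2)" by simp
  have "total_rec 1 (\<lambda>xs. rec_nat 0 (\<lambda>k v. v + k mod 2) (xs ! 0))"
    by (intro total_rec_rec_nat total_rec_add partial_rec_comp1[OF mod2] total_rec_intros) auto
  \<comment> \<open>Half of \<open>m\<close> is the number of odd numbers below
    \<open>m\<close>.\<close>
  moreover have "rec_nat 0 (\<lambda>k v. v + k mod 2) m = m div 2" for m :: nat
    by (induction m) (simp, simp, presburger)
  ultimately have div2: "total_rec 1 (\<lambda>xs. xs ! 0 div 2)" by simp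
  have "total_rec 2 (\<lambda>xs. rec_nat (xs ! 1) (\<lambda>k v. v div 2) (xs ! 0))"
    by (intro total_rec_rec_nat partial_rec_comp1[OF div2] total_rec_intros) auto
  moreover have "rec_nat m (\<lambda>k v. v div 2) k = m div 2 ^ k" for m k :: nat
    by (induction k) (simp, simp add: div_mult2_eq [symmetric] mult.commute)
  ultimately have shift: "total_rec 2 (\<lambda>xs. xs ! 1 div 2 ^ (xs ! 0))" by simp
  have "total_rec n (\<lambda>xs. if (c xs div 2 ^ a xs) mod 2 = 0 then y xs else x xs)"
    using assms
    by (intro total_rec_if_zero partial_rec_comp1[OF mod2]
        partial_rec_comp2[where f = "\<lambda>k m. Some (m div 2 ^ k)", OF shift])
  then show ?thesis
    by (rule partial_rec_cong) (simp add: set_decode_def even_iff_mod_2_eq_zero)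
qed

section \<open>Partial computable functions and indices of finite sets\<close>

lemma partial_computable_iff_partial_rec: "f \<in> partial_computable \<longleftrightarrow> partial_rec 1 (\<lambda>xs. f (xs ! 0))"
proof
  assume "partial_rec 1 (\<lambda>xs. f (xs ! 0))"
  then obtain F where "partial_recursive 1 F" "\<forall>xs. length xs = 1 \<longrightarrow> F xs = f (xs ! 0)"
    unfolding partial_rec_def by blast
  then show "f \<in> partial_computable"
    unfolding partial_computable_def by force
qed (auto simp: partial_computable_def partial_rec_def length_Suc_conv)

lemma partial_computable2I:
  assumes "partial_rec 2 (\<lambda>xs. f (xs ! 0) (xs ! 1))"
  shows "f \<in> partial_computable2"
proof -
  obtain F where "partial_recursive 2 F" "\<forall>xs. length xs = 2 \<longrightarrow> F xs = f (xs ! 0) (xs ! 1)"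
    using assms unfolding partial_rec_def by blast
  then show ?thesis
    unfolding partial_computable2_def by force
qed

text \<open>Deciding \<open>x \<in> set_decode c\<close> is effective in \<open>c\<close> and
  \<open>x\<close> together, so acceptability translates this numbering of the finite sets into
  \<phi>.\<close>

lemma finite_set_C_index:
  assumes "acceptable_numbering \<phi>"
  obtains t where "(\<lambda>c. Some (t c)) \<in> total_computable"
    "\<And>c. is_C_index \<phi> (t c)" "\<And>c. C_set \<phi> (t c) = set_decode c"
proof -
  let ?\<psi> = "\<lambda>c x. Some (if x \<in> set_decode c then 1 else 0)"
  have "?\<psi> \<in> partial_computable2"
    by (intro partial_computable2I total_rec_if_mem_set_decode total_rec_intros) auto
  then have "\<exists>t. (\<lambda>c. Some (t c)) \<in> total_computable \<and> (\<forall>c. \<phi> (t c) = ?\<psi> c)"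
    using assms unfolding acceptable_numbering_def by (elim conjE bspec)
  then obtain t where t: "(\<lambda>c. Some (t c)) \<in> total_computable" "\<And>c. \<phi> (t c) = ?\<psi> c"
    by auto
  show ?thesis
    by (rule that[OF t(1)]) (auto simp: t(2) is_C_index_def C_set_def)
qed

section \<open>The set-driven learner\<close>

text \<open>Each \<open>y\<close> has a fixed slot, so sets agreeing below \<open>m\<close> have
  texts agreeing before \<open>2 * m\<close>. The odd pauses recur forever even for
  \<open>D = UNIV\<close>, so a limit hypothesis is always stable under pauses.\<close>

definition padded_text :: "nat set \<Rightarrow> nat_text" where
  "padded_text D n = (if even n \<and> n div 2 \<in> D then Some (n div 2) else None)"

text \<open>Elements of \<open>set_decode c\<close> are below \<open>c\<close>, so
  \<open>2 * c\<close> steps read them all. The datum code 0 is the pause.\<close>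

definition sd_learner :: "(nat \<Rightarrow> nat) \<Rightarrow> learner \<Rightarrow> learner" where
  "sd_learner t h c = Option.bind (It h (padded_text (set_decode c)) (2 * c))
     (\<lambda>e. Option.bind (h (list_encode [e, 0])) (\<lambda>e'. Some (if e' = e then e else t c)))"

lemma content_iff: "x \<in> content T \<longleftrightarrow> (\<exists>n. T n = Some x)"
  by (auto simp: content_def Option.these_def image_iff)

lemma content_padded_text [simp]: "content (padded_text D) = D"
proof (intro set_eqI iffI)
  fix x assume "x \<in> D"
  then have "padded_text D (2 * x) = Some x" by (simp add: padded_text_def)
  then show "x \<in> content (padded_text D)" unfolding content_iff by blast
qed (auto simp: content_iff padded_text_def split: if_splits)

text \<open>One recursion step covers two positions, the slot of \<open>y\<close> and the pause
  after it, with data written as codes; this form fits \<open>partial_rec_rec_nat\<close>. The start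
  is \<open>h 0\<close> because the empty list has code 0.\<close>

lemma It_padded_text_eq_rec:
  "It h (padded_text D) (2 * m) = rec_nat (h 0) (\<lambda>y r. Option.bind r (\<lambda>e.
     Option.bind (h (list_encode [e, if y \<in> D then Suc y else 0]))
       (\<lambda>e'. h (list_encode [e', 0])))) m"
  by (induction m)
    (auto simp: padded_text_def datum_encode_def bind_assoc simp del: list_encode.simps(2)
      intro!: Option.bind_cong)

section \<open>Computability of the set-driven learner\<close>

lemma sd_learner_partial_computable:
  assumes "h \<in> partial_computable" "(\<lambda>c. Some (t c)) \<in> partial_computable"
  shows "sd_learner t h \<in> partial_computable"
proof -
  have h: "partial_rec 1 (\<lambda>xs. h (xs ! 0))" and t: "partial_rec 1 (\<lambda>xs. Some (t (xs ! 0)))"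
    using assms by (simp_all add: partial_computable_iff_partial_rec)
  show ?thesis
    unfolding partial_computable_iff_partial_rec sd_learner_def It_padded_text_eq_rec
    by (intro partial_rec_bind partial_rec_rec_nat partial_rec_comp1[OF h] partial_rec_comp1[OF t] total_rec_if_eq total_rec_if_mem_set_decode
        total_rec_list_encode_pair total_rec_intros) auto
qed

lemma It_defined: "\<forall>x. h x \<noteq> None \<Longrightarrow> It h T n \<noteq> None"
  by (induction n) auto

lemma sd_learner_total_computable:
  assumes "h \<in> total_computable" "(\<lambda>c. Some (t c)) \<in> partial_computable"
  shows "sd_learner t h \<in> total_computable"
proof -
  have h: "\<forall>x. h x \<noteq> None" using assms by (simp add: total_computable_def)
  then have "sd_learner t h c \<noteq> None" for c
    using It_defined[OF h] by (auto simp: sd_learner_def bind_eq_None_conv)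
  with assms sd_learner_partial_computable show ?thesis
    by (simp add: total_computable_def)
qed

section \<open>Prefixes of texts and preservation of C-indices\<close>

lemma It_prefix_cong: "(\<And>i. i < n \<Longrightarrow> T i = T' i) \<Longrightarrow> It h T n = It h T' n"
  by (induction n) auto

text \<open>Splicing a padded text for \<open>M\<close> behind a prefix makes properties of runs on
  texts for \<open>M\<close> available on texts for subsets of \<open>M\<close>.\<close>

lemma extend_prefix_to_text:
  assumes "content T \<subseteq> M"
  obtains T' where "content T' = M" "\<And>i. i < n \<Longrightarrow> T' i = T i"
proof
  let ?T' = "\<lambda>i. if i < n then T i else padded_text M (i - n)"
  show "content ?T' = M"
  proof (intro set_eqI iffI)
    fix x assume "x \<in> M"
    then have "?T' (n + 2 * x) = Some x" by (simp add: padded_text_def)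
    then show "x \<in> content ?T'" unfolding content_iff by blast
  next
    fix x assume "x \<in> content ?T'"
    then show "x \<in> M"
      using assms by (auto simp: content_iff subset_iff padded_text_def split: if_splits)
  qed
qed simp

lemma mem_set_decode_less: "x \<in> set_decode c \<Longrightarrow> x < c"
proof -
  assume "x \<in> set_decode c"
  then have "2 ^ x \<le> c"
    by (auto simp: set_decode_def intro!: leI)
  then show "x < c"
    using less_exp[of x] by linarith
qed

lemma padded_text_beyond_code: "2 * c \<le> n \<Longrightarrow> padded_text (set_decode c) n = None"
  using mem_set_decode_less[of "n div 2" c] by (auto simp: padded_text_def)

text \<open>Position \<open>2 * c\<close> holds a pause, so the extra pause tried by
  \<open>sd_learner\<close> is the next step on the same text.\<close>

lemma It_Suc_beyond_code:
  "It h (padded_text (set_decode c)) (Suc (2 * c)) =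
   Option.bind (It h (padded_text (set_decode c)) (2 * c)) (\<lambda>e. h (list_encode [e, 0]))"
  by (simp add: padded_text_beyond_code datum_encode_def)

text \<open>Both hypotheses computed by \<open>sd_learner\<close> occur in a run on a text for
  \<open>M\<close>. Hence the first is a C-index and the second is defined, so the test terminates;
  the output is the first or \<open>t c\<close>.\<close>

lemma sd_learner_C_index:
  assumes t: "is_C_index \<phi> (t c)" and sub: "set_decode c \<subseteq> M"
    and ind: "\<And>T. content T = M \<Longrightarrow> CInd \<phi> (It h T) T"
  shows "\<exists>e. sd_learner t h c = Some e \<and> is_C_index \<phi> e"
proof -
  let ?P = "padded_text (set_decode c)"
  obtain T where T: "content T = M" "\<And>i. i < Suc (2 * c) \<Longrightarrow> T i = ?P i"
    using extend_prefix_to_text[of ?P M] sub by auto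
  have "It h ?P (2 * c) = It h T (2 * c)" "It h ?P (Suc (2 * c)) = It h T (Suc (2 * c))"
    by (rule It_prefix_cong; simp add: T(2))+
  with ind[OF T(1)] obtain e e' where "It h ?P (2 * c) = Some e" "is_C_index \<phi> e"
      "It h ?P (Suc (2 * c)) = Some e'"
    unfolding CInd_def by metis
  with t show ?thesis
    unfolding It_Suc_beyond_code by (auto simp: sd_learner_def)
qed

lemma Sd_CInd:
  assumes t: "\<And>c. is_C_index \<phi> (t c)"
    and ind: "\<And>T'. content T' = content T \<Longrightarrow> CInd \<phi> (It h T') T'"
  shows "CInd \<phi> (Sd (sd_learner t h) T) T"
  unfolding CInd_def Sd_def
proof
  fix i
  have "finite (content_seq (text_prefix T i))" "content_seq (text_prefix T i) \<subseteq> content T"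
    by (auto simp: content_seq_def content_def text_prefix_def Option.these_def)
  then show "\<exists>e. sd_learner t h (set_encode (content_seq (text_prefix T i))) = Some e \<and>
      is_C_index \<phi> e"
    using t ind by (intro sd_learner_C_index) auto
qed

section \<open>Convergence on finite and infinite targets\<close>

lemma sd_learner_finite:
  assumes t: "is_C_index \<phi> (t c)" "C_set \<phi> (t c) = set_decode c"
    and ex: "\<And>T. content T = set_decode c \<Longrightarrow> Ex_C \<phi> (It h T) T"
  shows "\<exists>e. sd_learner t h c = Some e \<and> is_C_index \<phi> e \<and> C_set \<phi> e = set_decode c"
proof -
  let ?P = "padded_text (set_decode c)"
  obtain n0 e0 where n0: "It h ?P n0 = Some e0" "\<And>n. n \<ge> n0 \<Longrightarrow> It h ?P n = It h ?P n0"
    and e0: "is_C_index \<phi> e0" "C_set \<phi> e0 = set_decode c"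
    using ex[of ?P] unfolding Ex_C_def content_padded_text by blast
  \<comment> \<open>\<open>It\<close> never recovers from an undefined value, so convergence forces
    definedness everywhere.\<close>
  have def: "It h ?P n \<noteq> None" for n
  proof
    assume "It h ?P n = None"
    then have "It h ?P (n + k) = None" for k by (induction k) auto
    with n0 show False by (metis le_add2 option.distinct(1))
  qed
  obtain e where e: "It h ?P (2 * c) = Some e" using def by blast
  obtain e' where e': "h (list_encode [e, 0]) = Some e'"
    using def[of "Suc (2 * c)"] e unfolding It_Suc_beyond_code by auto
  \<comment> \<open>From position \<open>2 * c\<close> on there are only pauses, so a hypothesis
    kept by one of them is kept forever and is the limit. If it is not kept, the output
    \<open>t c\<close> is correct by choice of \<open>t\<close>.\<close>
  have "e = e0" if "e' = e"
  proof -
    have "It h ?P (2 * c + k) = Some e" for k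
      using e e' that
      by (induction k) (simp_all add: padded_text_beyond_code datum_encode_def del: list_encode.simps)
    then show ?thesis using n0 by (metis le_add2 option.inject)
  qed
  then show ?thesis
    using e e' t e0 by (auto simp: sd_learner_def)
qed

text \<open>The two runs coincide up to \<open>2 * m\<close>. Later each datum of \<open>D\<close>
  is a pause or the datum of \<open>L\<close> at the same position, and \<open>e\<close> survives
  both.\<close>

lemma It_padded_text_stable:
  assumes stable: "\<And>n. n \<ge> 2 * m \<Longrightarrow> It h (padded_text L) n = Some e"
    and D: "D \<subseteq> L" "\<And>x. x < m \<Longrightarrow> x \<in> L \<Longrightarrow> x \<in> D" and n: "n \<ge> 2 * m"
  shows "It h (padded_text D) n = Some e"
  using n
proof (induction n rule: dec_induct)
  case base
  have "It h (padded_text D) (2 * m) = It h (padded_text L) (2 * m)"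
    by (rule It_prefix_cong) (use D in \<open>auto simp: padded_text_def\<close>)
  with stable show ?case by simp
next
  case (step n)
  have step_L: "h (list_encode [e, datum_encode (padded_text L i)]) = Some e" if "i \<ge> 2 * m" for i
    using stable[of i] stable[of "Suc i"] that by (simp del: list_encode.simps)
  have "h (list_encode [e, datum_encode (padded_text D n)]) = Some e"
  proof (cases "padded_text D n")
    case None
    \<comment> \<open>At this odd position the text for \<open>L\<close> has a pause, so
      \<open>e\<close> survives pauses.\<close>
    with step_L[of "Suc (2 * m)"] show ?thesis by (simp add: padded_text_def del: list_encode.simps)
  next
    case (Some x)
    then have "padded_text D n = padded_text L n"
      using D by (auto simp: padded_text_def split: if_splits)
    with step_L[of n] step.hyps show ?thesis by (simp del: list_encode.simps)
  qed
  with step.IH show ?case by (simp del: list_encode.simps)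
qed

lemma sd_learner_infinite:
  assumes inf: "infinite L" and ex: "Ex_C \<phi> (It h (padded_text L)) (padded_text L)"
  obtains m e where "is_C_index \<phi> e" "C_set \<phi> e = L"
    "\<And>c. set_decode c \<subseteq> L \<Longrightarrow> L \<inter> {..m} \<subseteq> set_decode c \<Longrightarrow> sd_learner t h c = Some e"
proof -
  obtain n0 e where e: "It h (padded_text L) n0 = Some e"
      "\<And>n. n \<ge> n0 \<Longrightarrow> It h (padded_text L) n = It h (padded_text L) n0"
      "is_C_index \<phi> e" "C_set \<phi> e = L"
    using ex unfolding Ex_C_def content_padded_text by blast
  have stable: "It h (padded_text L) n = Some e" if "n \<ge> 2 * n0" for n
    using e(1) e(2)[of n] that by simp
  \<comment> \<open>Once this \<open>m\<close> is in the observed set, the code \<open>c\<close>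
    exceeds \<open>n0\<close>, so the learner reads off its hypothesis at \<open>2 * c\<close>, past
    the point of convergence. Infinity of \<open>L\<close> provides \<open>m\<close>.\<close>
  obtain m where m: "m \<in> L" "m \<ge> n0"
    using inf unfolding infinite_nat_iff_unbounded_le by blast
  show ?thesis
  proof
    fix c assume c: "set_decode c \<subseteq> L" "L \<inter> {..m} \<subseteq> set_decode c"
    have "m < c" using m c mem_set_decode_less by auto
    have It: "It h (padded_text (set_decode c)) n = Some e" if "n \<ge> 2 * n0" for n
      by (rule It_padded_text_stable[OF stable c(1) _ that]) (use c m in auto)
    have "It h (padded_text (set_decode c)) (2 * c) = Some e"
      "It h (padded_text (set_decode c)) (Suc (2 * c)) = Some e"
      using \<open>m < c\<close> m by (auto intro!: It simp del: It.simps)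
    then show "sd_learner t h c = Some e"
      unfolding It_Suc_beyond_code by (simp add: sd_learner_def del: list_encode.simps)
  qed (use e(3,4) in auto)
qed

lemma content_prefix_eventually:
  assumes "finite A" "A \<subseteq> content T"
  shows "\<exists>n. \<forall>i\<ge>n. A \<subseteq> content_seq (text_prefix T i)"
  using assms
proof (induction A rule: finite_induct)
  case (insert x A)
  then obtain n where n: "\<forall>i\<ge>n. A \<subseteq> content_seq (text_prefix T i)" by auto
  obtain k where k: "T k = Some x" using insert.prems by (auto simp: content_iff)
  have "x \<in> content_seq (text_prefix T i)" if "i > k" for i
    using k that by (force simp: content_seq_def text_prefix_def Option.these_def image_iff)
  with n show ?case
    by (intro exI[of _ "max n (Suc k)"]) auto
qed simp

text \<open>For finite content the input itself becomes constant. For infinite content it keeps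
  changing, but once it contains the finite part up to \<open>m\<close>, the output stays at one
  fixed \<open>e\<close>.\<close>

lemma Sd_Ex_C:
  assumes t: "\<And>c. is_C_index \<phi> (t c)" "\<And>c. C_set \<phi> (t c) = set_decode c"
    and ex: "\<And>T'. content T' = content T \<Longrightarrow> Ex_C \<phi> (It h T') T'"
  shows "Ex_C \<phi> (Sd (sd_learner t h) T) T"
proof -
  let ?D = "\<lambda>i. content_seq (text_prefix T i)"
  have fin: "finite (?D i)" and sub: "?D i \<subseteq> content T" for i
    by (auto simp: content_seq_def content_def text_prefix_def Option.these_def)
  show ?thesis
  proof (cases "finite (content T)")
    case True
    then obtain n where n: "\<forall>i\<ge>n. content T \<subseteq> ?D i"
      using content_prefix_eventually by blast
    then have eq: "?D i = content T" if "i \<ge> n" for i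
      using sub that by blast
    let ?c = "set_encode (content T)"
    obtain e where "sd_learner t h ?c = Some e" "is_C_index \<phi> e" "C_set \<phi> e = set_decode ?c"
      using sd_learner_finite[of \<phi> t ?c h] t ex True by auto
    then show ?thesis
      using eq True unfolding Ex_C_def Sd_def by (intro exI[of _ n] exI[of _ e]) auto
  next
    case False
    obtain m e where e: "is_C_index \<phi> e" "C_set \<phi> e = content T"
      "\<And>c. set_decode c \<subseteq> content T \<Longrightarrow> content T \<inter> {..m} \<subseteq> set_decode c \<Longrightarrow>
         sd_learner t h c = Some e"
      using sd_learner_infinite[OF False ex] by (metis content_padded_text)
    obtain n where n: "\<forall>i\<ge>n. content T \<inter> {..m} \<subseteq> ?D i"
      using content_prefix_eventually[of "content T \<inter> {..m}" T] by auto
    have "sd_learner t h (set_encode (?D i)) = Some e" if "i \<ge> n" for i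
      using n that fin sub by (intro e(3)) auto
    then show ?thesis
      using e(1,2) unfolding Ex_C_def Sd_def by (intro exI[of _ n] exI[of _ e]) auto
  qed
qed

theorem theorem4:
  fixes \<phi> :: "nat \<Rightarrow> nat \<Rightarrow> nat option"
    and \<delta> \<delta>' :: restriction
    and \<C> :: "learner set"
  assumes "acceptable_numbering \<phi>"
    and "\<delta> \<in> {CInd \<phi>, no_restriction}"
    and "\<delta>' \<in> {CInd \<phi>, no_restriction}"
    and "\<C> \<in> {total_computable, partial_computable}"
  shows "learnable_REC \<delta>' \<C> It (restriction_conj \<delta> (Ex_C \<phi>))
       \<subseteq> learnable_REC \<delta>' \<C> Sd (restriction_conj \<delta> (Ex_C \<phi>))"
proof
  fix \<L> assume "\<L> \<in> learnable_REC \<delta>' \<C> It (restriction_conj \<delta> (Ex_C \<phi>))"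
  then obtain h where rec: "\<L> \<subseteq> REC" and h: "h \<in> \<C>"
    and learns: "\<And>L. L \<in> \<L> \<Longrightarrow> learns \<delta>' It (restriction_conj \<delta> (Ex_C \<phi>)) h L"
    unfolding learnable_REC_def by blast
  obtain t where t: "(\<lambda>c. Some (t c)) \<in> total_computable"
    "\<And>c. is_C_index \<phi> (t c)" "\<And>c. C_set \<phi> (t c) = set_decode c"
    using finite_set_C_index[OF assms(1)] by blast
  \<comment> \<open>The premise concerns only texts with the content of \<open>T\<close>, so the
    same fact serves \<delta> on texts for a target and \<delta>' on all texts.\<close>
  have transfer: "\<epsilon> (Sd (sd_learner t h) T) T"
    if "\<epsilon> \<in> {CInd \<phi>, no_restriction}" "\<And>T'. content T' = content T \<Longrightarrow> \<epsilon> (It h T') T'" for \<epsilon> T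
    using that Sd_CInd[of \<phi> t T h] t(2) by (auto simp: no_restriction_def)
  have "sd_learner t h \<in> \<C>"
    using assms(4) h t(1) sd_learner_partial_computable sd_learner_total_computable
    by (auto simp: total_computable_def)
  moreover have "learns \<delta>' Sd (restriction_conj \<delta> (Ex_C \<phi>)) (sd_learner t h) L" if "L \<in> \<L>" for L
    using learns[OF that] transfer[OF assms(2)] transfer[OF assms(3)] Sd_Ex_C[OF t(2,3)]
    unfolding learns_def restriction_conj_def is_text_for_def by blast
  ultimately show "\<L> \<in> learnable_REC \<delta>' \<C> Sd (restriction_conj \<delta> (Ex_C \<phi>))"
    using rec unfolding learnable_REC_def by blast
qed

end
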